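(* Let $f \in \mathcal{S}^*_{L}$ (the class of starlike functions associated with the lune), $f(z)=z+\sum_{n=2}^{\infty}a_nz^n$, and let $\Gamma_1,\Gamma_2$ be the first two inverse logarithmic coefficients of $f$. Then $$-\frac{1}{\sqrt{10}}\le |\Gamma_2|-|\Gamma_1|\le \frac14 .$$ Both inequalities are sharp, i.e. for each of the two inequalities there exists $f\in\mathcal{S}^*_{L}$ for which equality holds.
   Context: Let $\mathbb{D}=\{z\in\mathbb{C}:|z|<1\}$. $\mathcal{A}$ denotes the class of functions $f$ analytic in $\mathbb{D}$ with $f(0)=0$ and $f'(0)=1$, so $f(z)=z+\sum_{n=2}^\infty a_n z^n$; $\mathcal{S}$ is the subclass of univalent functions in $\mathcal{A}$. For analytic functions $g,h$ on $\mathbb{D}$, $g$ is subordinate to $h$, written $g\prec h$, if there is an analytic $\omega$ on $\mathbb{D}$ with $\omega(0)=0$ and $|\omega(z)|<1$ such that $g(z)=h(\omega(z))$ for all $z\in\mathbb{D}$. Let $q(z)=z+\sqrt{1+z^2}$, $z\in\mathbb{D}$, with the branch of the square root chosen so that $q(0)=1$. The class of starlike functions associated with the lune (written here $\mathcal{S}^*_{L}$) is $$\mathcal{S}^*_{L}=\left\{f\in\mathcal{S}: \frac{zf'(z)}{f(z)}\prec q(z)\right\},$$ where $zf'(z)/f(z)$ is given the value $1$ at $z=0$. Equivalently, it is the class of $f\in\mathcal{S}$ with $\left|\left(\frac{zf'(z)}{f(z)}\right)^2-1\right|\le 2\left|\frac{zf'(z)}{f(z)}\right|$ for all $z\in\mathbb{D}$.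 For $f\in\mathcal{A}$, let $f^{-1}$ be its local inverse near the origin with $f^{-1}(0)=0$. The inverse logarithmic coefficients $\Gamma_n$ of $f$ are defined by $$\log\frac{f^{-1}(w)}{w}=2\sum_{n=1}^\infty \Gamma_n w^n$$ for $w$ in a neighborhood of $0$, with the branch of the logarithm satisfying $\log 1=0$. In terms of the Taylor coefficients of $f$, $\Gamma_1=-\frac12 a_2$ and $\Gamma_2=-\frac12 a_3+\frac34 a_2^2$. *)

theory Defs
  imports "HOL-Complex_Analysis.Complex_Analysis"
begin

text \<open>
  Functions on the open unit disc \<open>ball 0 1\<close> are represented by total functions on \<^typ>\<open>complex\<close>;
  their values outside the disc play no role in any of the notions below.
\<close>

definition class_A :: "(complex \<Rightarrow> complex) set" where
  "class_A = {f. f holomorphic_on ball 0 1 \<and> f 0 = 0 \<and> deriv f 0 = 1}"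

definition class_S :: "(complex \<Rightarrow> complex) set" where
  "class_S = {f \<in> class_A. inj_on f (ball 0 1)}"

definition subordinate :: "(complex \<Rightarrow> complex) \<Rightarrow> (complex \<Rightarrow> complex) \<Rightarrow> bool" where
  "subordinate g h \<longleftrightarrow>
     g holomorphic_on ball 0 1 \<and> h holomorphic_on ball 0 1 \<and>
     (\<exists>\<omega>. \<omega> holomorphic_on ball 0 1 \<and> \<omega> 0 = 0 \<and>
          (\<forall>z\<in>ball 0 1. cmod (\<omega> z) < 1) \<and>
          (\<forall>z\<in>ball 0 1. g z = h (\<omega> z)))"

text \<open>For \<open>|z| < 1\<close> we have \<open>Re (1 + z\<^sup>2) > 0\<close>, so the principal square root is analytic
  there, with value \<open>1\<close> at \<open>z = 0\<close>.\<close>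

definition lune :: "complex \<Rightarrow> complex" where
  "lune z = z + csqrt (1 + z\<^sup>2)"

definition class_S_lune :: "(complex \<Rightarrow> complex) set" where
  "class_S_lune =
     {f \<in> class_S. subordinate (\<lambda>z. if z = 0 then 1 else z * deriv f z / f z) lune}"

definition is_local_inverse :: "(complex \<Rightarrow> complex) \<Rightarrow> (complex \<Rightarrow> complex) \<Rightarrow> bool" where
  "is_local_inverse f g \<longleftrightarrow>
     (\<exists>r>0. g holomorphic_on ball 0 r \<and> g 0 = 0 \<and>
            (\<forall>w\<in>ball 0 r. g w \<in> ball 0 1 \<and> f (g w) = w))"

definition local_inverse :: "(complex \<Rightarrow> complex) \<Rightarrow> complex \<Rightarrow> complex" where
  "local_inverse f = (SOME g. is_local_inverse f g)"

text \<open>The quotient \<open>g w / w\<close> has a removable singularity at \<open>0\<close> with value \<open>g' 0 = 1\<close> if \<open>g\<close> is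
  a local inverse of a function in \<^const>\<open>class_A\<close>; near \<open>1\<close>, \<^const>\<open>Ln\<close> is the branch of the
  logarithm that vanishes at \<open>1\<close>.\<close>

definition log_quotient :: "(complex \<Rightarrow> complex) \<Rightarrow> complex \<Rightarrow> complex" where
  "log_quotient g w = (if w = 0 then 0 else Ln (g w / w))"

definition inv_log_coeff :: "(complex \<Rightarrow> complex) \<Rightarrow> nat \<Rightarrow> complex" where
  "inv_log_coeff f n = fps_nth (fps_expansion (log_quotient (local_inverse f)) 0) n / 2"

text \<open>The choice made in \<^const>\<open>local_inverse\<close> is immaterial: a local inverse exists, and the
  defining expansion of the inverse logarithmic coefficients holds for every local inverse.\<close>

lemma is_local_inverse_local_inverse:
  assumes "f \<in> class_A"
  shows   "is_local_inverse f (local_inverse f)"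
proof -
  have f: "f holomorphic_on ball 0 1" "f 0 = 0" "deriv f 0 = 1"
    using assms by (auto simp: class_A_def)
  obtain r where r: "r > 0" "ball 0 r \<subseteq> ball (0::complex) 1" "open (f ` ball 0 r)" "inj_on f (ball 0 r)"
    using has_complex_derivative_locally_invertible[OF f(1), of 0] f(3) by auto
  obtain g where g: "g holomorphic_on f ` ball 0 r" "\<And>z. z \<in> ball 0 r \<Longrightarrow> g (f z) = z"
    using holomorphic_has_inverse[OF holomorphic_on_subset[OF f(1) r(2)] _ r(4)] by (metis open_ball)
  have "0 \<in> f ` ball 0 r"
    using r(1) f(2) by (metis centre_in_ball imageI)
  then obtain e where e: "e > 0" "ball 0 e \<subseteq> f ` ball 0 r"
    using r(3) openE by blast
  have "g 0 = 0"
    using g(2)[of 0] f(2) r(1) by simp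
  moreover have "g w \<in> ball 0 1 \<and> f (g w) = w" if "w \<in> ball 0 e" for w
    using that e(2) g(2) r(2) by (smt (verit, best) imageE subsetD)
  ultimately have "is_local_inverse f g"
    unfolding is_local_inverse_def using e g(1) holomorphic_on_subset by blast
  thus ?thesis
    unfolding local_inverse_def by (rule someI[of "is_local_inverse f"])
qed

lemma is_local_inverse_unique:
  assumes f: "f \<in> class_A" and g: "is_local_inverse f g" and h: "is_local_inverse f h"
  shows   "eventually (\<lambda>w. g w = h w) (nhds 0)"
proof -
  have hol: "f holomorphic_on ball 0 1" "deriv f 0 = 1"
    using f by (auto simp: class_A_def)
  obtain r where r: "r > 0" "inj_on f (ball 0 r)"
    using has_complex_derivative_locally_invertible[OF hol(1), of 0] hol(2) by auto
  have *: "eventually (\<lambda>w. k w \<in> ball 0 r \<and> f (k w) = w) (nhds 0)" if k: "is_local_inverse f k" for k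
  proof -
    obtain s where s: "s > 0" "k holomorphic_on ball 0 s" "k 0 = 0"
        "\<forall>w\<in>ball 0 s. k w \<in> ball 0 1 \<and> f (k w) = w"
      using k by (auto simp: is_local_inverse_def)
    have "continuous (at 0) k"
      using holomorphic_on_imp_continuous_on[OF s(2)] s(1)
      by (simp add: continuous_on_eq_continuous_at)
    hence "filterlim k (nhds 0) (nhds 0)"
      using s(3) tendsto_at_iff_tendsto_nhds[of k 0] by (simp add: isCont_def)
    hence "eventually (\<lambda>w. k w \<in> ball 0 r) (nhds 0)"
      by (rule topological_tendstoD) (use r(1) in auto)
    moreover have "eventually (\<lambda>w. w \<in> ball 0 s) (nhds (0::complex))"
      using s(1) by (intro eventually_nhds_in_open) auto
    ultimately show ?thesis
      by eventually_elim (use s(4) in auto)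
  qed
  show ?thesis
    using *[OF g] *[OF h] by eventually_elim (use r(2) in \<open>auto simp: inj_on_def\<close>)
qed

lemma log_quotient_analytic:
  assumes f: "f \<in> class_A" and g: "is_local_inverse f g"
  shows   "log_quotient g analytic_on {0}"
proof -
  have hol: "f holomorphic_on ball 0 1" "f 0 = 0" "deriv f 0 = 1"
    using f by (auto simp: class_A_def)
  obtain s where s: "s > 0" "g holomorphic_on ball 0 s" "g 0 = 0"
      "\<forall>w\<in>ball 0 s. g w \<in> ball 0 1 \<and> f (g w) = w"
    using g by (auto simp: is_local_inverse_def)
  have "(f has_field_derivative 1) (at (g 0))"
    using hol s(3) by (metis centre_in_ball holomorphic_derivI less_numeral_extra(1) open_ball)
  moreover have dg: "(g has_field_derivative deriv g 0) (at 0)"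
    using s(1,2) by (metis centre_in_ball holomorphic_derivI open_ball)
  ultimately have "((\<lambda>w. f (g w)) has_field_derivative 1 * deriv g 0) (at 0)"
    by (rule DERIV_chain2)
  moreover have "((\<lambda>w. f (g w)) has_field_derivative 1) (at 0)"
    by (rule has_field_derivative_transform_within[of "\<lambda>w. w" _ _ _ s]) (use s in auto)
  ultimately have dg1: "deriv g 0 = 1"
    using DERIV_unique by force
  define k where "k = (\<lambda>w. if w = 0 then deriv g 0 else (g w - g 0) / (w - 0))"
  have k: "k holomorphic_on ball 0 s"
    unfolding k_def using pole_lemma_open[OF s(2) open_ball, of 0] by simp
  have k0: "k 0 = 1"
    by (simp add: k_def dg1)
  have "k analytic_on {0}"
    using k s(1) by (metis analytic_at centre_in_ball open_ball)
  moreover have "k 0 \<notin> \<real>\<^sub>\<le>\<^sub>0"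
    by (simp add: k0)
  ultimately have "(\<lambda>w. Ln (k w)) analytic_on {0}"
    by (intro analytic_intros) auto
  also have "(\<lambda>w. Ln (k w)) = log_quotient g"
    using k0 by (auto simp: k_def log_quotient_def s(3))
  finally show ?thesis .
qed

lemma inv_log_coeff_expansion:
  assumes f: "f \<in> class_A" and g: "is_local_inverse f g"
  shows   "inv_log_coeff f 0 = 0"
    and   "eventually (\<lambda>w. (\<lambda>n. 2 * inv_log_coeff f n * w ^ n) sums Ln (g w / w)) (at 0)"
proof -
  show "inv_log_coeff f 0 = 0"
    by (simp add: inv_log_coeff_def log_quotient_def fps_expansion_def)
  have "log_quotient g has_fps_expansion fps_expansion (log_quotient g) 0"
    using log_quotient_analytic[OF f g] analytic_at_imp_has_fps_expansion_0 by blast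
  also have "fps_expansion (log_quotient g) 0 = fps_expansion (log_quotient (local_inverse f)) 0"
  proof (rule fps_expansion_cong)
    show "eventually (\<lambda>w. log_quotient g w = log_quotient (local_inverse f) w) (nhds 0)"
      using is_local_inverse_unique[OF f g is_local_inverse_local_inverse[OF f]]
      by eventually_elim (simp add: log_quotient_def)
  qed
  finally have *: "log_quotient g has_fps_expansion
                     fps_expansion (log_quotient (local_inverse f)) 0" (is "_ has_fps_expansion ?F") .
  have R: "fps_conv_radius ?F > 0" and ev: "eventually (\<lambda>w. eval_fps ?F w = log_quotient g w) (nhds 0)"
    using * by (auto simp: has_fps_expansion_def)
  have "eventually (\<lambda>w. w \<in> eball 0 (fps_conv_radius ?F)) (nhds 0)"
    using R by (intro eventually_nhds_in_open) (auto simp: zero_ereal_def)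
  hence "eventually (\<lambda>w. w \<in> eball 0 (fps_conv_radius ?F)) (at 0)"
    unfolding eventually_at_filter by (rule eventually_mono) auto
  moreover have "eventually (\<lambda>w. eval_fps ?F w = log_quotient g w) (at 0)"
    using ev unfolding eventually_at_filter by (rule eventually_mono) auto
  moreover have "eventually (\<lambda>w. w \<noteq> 0) (at (0::complex))"
    by (simp add: eventually_at_filter)
  ultimately show "eventually (\<lambda>w. (\<lambda>n. 2 * inv_log_coeff f n * w ^ n) sums Ln (g w / w)) (at 0)"
  proof eventually_elim
    case (elim w)
    hence "(\<lambda>n. fps_nth ?F n * w ^ n) sums eval_fps ?F w"
      by (intro sums_eval_fps) auto
    thus ?case
      using elim by (simp add: inv_log_coeff_def log_quotient_def)
  qed
qed

end

theory Submission
  imports Defs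
begin

text \<open>
  Let \<open>z f'(z) / f(z) = lune (\<omega>(z))\<close> with a Schwarz function \<open>\<omega>(z) = z h(z)\<close>. The first two
  inverse logarithmic coefficients depend only on \<open>c\<^sub>1 = h(0)\<close> and \<open>c\<^sub>2 = h'(0)\<close>, the first two
  coefficients of \<open>\<omega>\<close>:
  \<open>\<Gamma>\<^sub>1 = - c\<^sub>1 / 2\<close> and \<open>\<Gamma>\<^sub>2 = 3 c\<^sub>1\<^sup>2 / 8 - c\<^sub>2 / 4\<close> (\<open>inv_log_coeff_1_2\<close>). With \<open>c = |c\<^sub>1|\<close> and the
  Schwarz--Pick inequality \<open>|c\<^sub>2| \<le> 1 - c\<^sup>2\<close> (\<open>Schwarz_Pick_quotient\<close>), the triangle inequality
  gives \<open>|\<Gamma>\<^sub>2| - |\<Gamma>\<^sub>1| \<le> 1/4 + c\<^sup>2/8 - c/2 \<le> 1/4\<close>, and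
  \<open>|\<Gamma>\<^sub>2| - |\<Gamma>\<^sub>1| \<ge> max 0 (5 c\<^sup>2/8 - 1/4) - c/2\<close>, whose minimum over \<open>0 \<le> c \<le> 1\<close> is attained where
  \<open>5 c\<^sup>2/8 = 1/4\<close>, that is at \<open>c = 2 / sqrt 10\<close>, and equals \<open>- 1 / sqrt 10\<close>.

  For sharpness take the Schwarz functions \<open>\<omega>(z) = z (z + c) / (1 + c z)\<close> with \<open>c = 0\<close> and with
  \<open>c = 2 / sqrt 10\<close>. That each of them comes from a function in the class
  (\<open>class_S_lune_of_Schwarz_function\<close>) requires univalence of the solution \<open>f\<close> of
  \<open>z f'(z) / f(z) = lune (\<omega>(z))\<close>: since \<open>lune\<close> has positive real part on the disc, the function
  \<open>\<zeta> \<mapsto> log f(exp \<zeta>)\<close> has a derivative of positive real part on the left half-plane, which is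
  convex, and is therefore injective there.
\<close>

section \<open>The lune function\<close>

lemma lune_mult_reciprocal: "lune z * (csqrt (1 + z\<^sup>2) - z) = 1"
proof -
  have "lune z * (csqrt (1 + z\<^sup>2) - z) = (csqrt (1 + z\<^sup>2))\<^sup>2 - z\<^sup>2"
    by (simp add: lune_def power2_eq_square algebra_simps del: power2_csqrt)
  thus ?thesis by simp
qed

lemma Re_one_plus_square_pos:
  assumes "cmod z < 1"
  shows   "Re (1 + z\<^sup>2) > 0"
proof -
  have "cmod (z\<^sup>2) < 1"
    using assms by (simp add: norm_power power_less_one_iff)
  thus ?thesis
    using abs_Re_le_cmod[of "z\<^sup>2"] by (simp del: power2_eq_square Re_power2)
qed

lemma Re_lune_pos:
  assumes "cmod z < 1"
  shows   "Re (lune z) > 0"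
proof -
  define s where "s = csqrt (1 + z\<^sup>2)"
  have "(Re s)\<^sup>2 \<ge> Re (s\<^sup>2)"
    by (simp add: power2_eq_square)
  moreover have "s\<^sup>2 = 1 + z\<^sup>2"
    by (simp add: s_def)
  hence "Re (s\<^sup>2) > 0"
    using Re_one_plus_square_pos[OF assms] by (simp only:)
  ultimately have "Re s \<noteq> 0"
    by auto
  moreover have "Re s \<ge> 0"
    unfolding s_def by (rule Re_csqrt)
  ultimately have s: "Re s > 0"
    by simp
  have prod: "lune z * (s - z) = 1"
    using lune_mult_reciprocal[of z] by (simp add: s_def)
  \<comment> \<open>\<open>s + z\<close> and \<open>s - z\<close> are reciprocal, so their real parts have the same sign;
      the sum of these real parts is \<open>2 Re s\<close>.\<close>
  have "s - z = inverse (lune z)"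
    using prod by (metis inverse_unique)
  hence "Re (s - z) = Re (lune z) / (cmod (lune z))\<^sup>2"
    by (simp add: cmod_power2)
  moreover have "Re (lune z) + Re (s - z) = 2 * Re s"
    by (simp add: lune_def s_def)
  ultimately have "Re (lune z) * (1 + 1 / (cmod (lune z))\<^sup>2) > 0"
    using s by (simp add: algebra_simps)
  thus ?thesis
    by (smt (verit) zero_less_mult_iff divide_nonneg_nonneg zero_le_power2)
qed

lemma lune_holomorphic: "lune holomorphic_on ball 0 1"
proof -
  have "1 + z\<^sup>2 \<notin> \<real>\<^sub>\<le>\<^sub>0" if "z \<in> ball 0 1" for z :: complex
    using Re_one_plus_square_pos[of z] that by (auto simp: complex_nonpos_Reals_iff)
  thus ?thesis
    unfolding lune_def by (intro holomorphic_intros) auto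
qed

section \<open>The first coefficient of a bounded function\<close>

text \<open>The Schwarz--Pick inequality at the origin, phrased for the quotient \<open>\<omega> z / z\<close>.\<close>

lemma Schwarz_Pick_quotient:
  assumes h: "h holomorphic_on ball 0 1" and bd: "\<And>z. z \<in> ball 0 1 \<Longrightarrow> cmod (z * h z) < 1"
  shows   "cmod (deriv h 0) \<le> 1 - (cmod (h 0))\<^sup>2"
proof -
  define \<omega> where "\<omega> = (\<lambda>z. z * h z)"
  have hol: "\<omega> holomorphic_on ball 0 1"
    unfolding \<omega>_def by (intro holomorphic_intros h)
  have \<omega>0: "\<omega> 0 = 0"
    by (simp add: \<omega>_def)
  have \<omega>1: "\<And>z. norm z < 1 \<Longrightarrow> norm (\<omega> z) < 1"
    using bd by (simp add: \<omega>_def)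
  have "(h has_field_derivative deriv h 0) (at 0)"
    using h by (metis centre_in_ball holomorphic_derivI less_numeral_extra(1) open_ball)
  hence "(\<omega> has_field_derivative h 0) (at 0)"
    unfolding \<omega>_def by (auto intro!: derivative_eq_intros)
  hence d\<omega>: "deriv \<omega> 0 = h 0"
    by (rule DERIV_imp_deriv)
  have Sch: "norm (\<omega> z) \<le> norm z" if "norm z < 1" for z
    using Schwarz_Lemma(1)[OF hol \<omega>0] \<omega>1 that by blast
  have le: "cmod (h z) \<le> 1" if "cmod z < 1" for z
  proof (cases "z = 0")
    case True
    thus ?thesis using Schwarz_Lemma(2)[of \<omega> 0] hol \<omega>0 \<omega>1 d\<omega> by simp
  next
    case False
    thus ?thesis using Sch[OF that] by (simp add: \<omega>_def norm_mult)
  qed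
  show ?thesis
  proof (cases "\<exists>z. cmod z < 1 \<and> cmod (h z) = 1")
    case True
    \<comment> \<open>By the equality case of the Schwarz lemma, \<open>h\<close> is a unimodular constant.\<close>
    then obtain z where "cmod z < 1" "cmod (h z) = 1" by blast
    hence "(\<exists>z. norm z < 1 \<and> z \<noteq> 0 \<and> norm (\<omega> z) = norm z) \<or> norm (deriv \<omega> 0) = 1"
      unfolding d\<omega> by (cases "z = 0") (auto simp: \<omega>_def norm_mult)
    then obtain \<alpha> where \<alpha>: "\<forall>z. norm z < 1 \<longrightarrow> \<omega> z = \<alpha> * z" "norm \<alpha> = 1"
      using Schwarz_Lemma(3)[OF hol \<omega>0, of 0] \<omega>1 by (metis norm_zero zero_less_one)
    have h0: "h 0 = \<alpha>"
    proof -
      have "(\<omega> has_field_derivative \<alpha>) (at 0)"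
        by (rule has_field_derivative_transform_within[of "\<lambda>z. \<alpha> * z" _ _ _ 1])
           (use \<alpha> in \<open>auto intro!: derivative_eq_intros\<close>)
      thus ?thesis using d\<omega> DERIV_imp_deriv by metis
    qed
    have "h z = \<alpha>" if "cmod z < 1" for z
    proof (cases "z = 0")
      case False
      have "z * h z = \<alpha> * z"
        using \<alpha>(1) that unfolding \<omega>_def by blast
      thus ?thesis using False by simp
    qed (simp add: h0)
    hence "(h has_field_derivative 0) (at 0)"
      by (intro has_field_derivative_transform_within[OF DERIV_const, of 1 0 UNIV \<alpha> h]) simp_all
    hence "deriv h 0 = 0"
      by (rule DERIV_imp_deriv)
    thus ?thesis
      using h0 \<alpha>(2) by simp
  next
    case False
    with le have lt: "cmod (h z) < 1" if "cmod z < 1" for z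
      using that by (metis order_le_less)
    define c where "c = h 0"
    have c: "cmod c < 1"
      by (simp add: c_def lt)
    \<comment> \<open>Moving \<open>h 0\<close> to the origin by a disc automorphism makes the Schwarz lemma applicable.\<close>
    define \<psi> where "\<psi> = (\<lambda>z. Moebius_function 0 c (h z))"
    have "\<psi> holomorphic_on ball 0 1"
      unfolding \<psi>_def
      by (rule holomorphic_on_compose_gen[OF h Moebius_function_holomorphic[OF c], unfolded o_def])
         (auto simp: lt)
    moreover have "\<psi> 0 = 0"
      by (simp add: \<psi>_def c_def Moebius_function_eq_zero)
    moreover have "cmod (\<psi> z) < 1" if "cmod z < 1" for z
      unfolding \<psi>_def using Moebius_function_norm_lt_1[OF c lt[OF that]] .
    ultimately have "cmod (deriv \<psi> 0) \<le> 1"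
      using Schwarz_Lemma(2)[of \<psi> 0] by simp
    have cc: "1 - cnj c * c = of_real (1 - (cmod c)\<^sup>2)"
      using complex_norm_square[of c] by (simp add: mult.commute)
    have pos: "1 - (cmod c)\<^sup>2 > 0"
      using c by (simp add: abs_square_less_1)
    hence nz: "1 - cnj c * c \<noteq> 0"
      using cc by (metis less_irrefl of_real_eq_0_iff)
    have "(h has_field_derivative deriv h 0) (at 0)" by fact
    hence "(\<psi> has_field_derivative deriv h 0 / (1 - cnj c * c)) (at 0)"
      unfolding \<psi>_def Moebius_function_simple using nz
      by (auto intro!: derivative_eq_intros simp: c_def[symmetric])
    hence "deriv \<psi> 0 = deriv h 0 / of_real (1 - (cmod c)\<^sup>2)"
      using DERIV_imp_deriv cc by metis
    hence "cmod (deriv \<psi> 0) = cmod (deriv h 0) / (1 - (cmod c)\<^sup>2)"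
      using pos by (simp only: norm_divide norm_of_real)
    with \<open>cmod (deriv \<psi> 0) \<le> 1\<close> show ?thesis
      using pos by (simp add: c_def)
  qed
qed

section \<open>Univalence of starlike functions\<close>

text \<open>The Noshiro--Warschawski criterion.\<close>

lemma inj_on_if_Re_deriv_pos:
  assumes S: "convex S"
    and F: "\<And>z. z \<in> S \<Longrightarrow> (F has_field_derivative F' z) (at z)"
    and pos: "\<And>z. z \<in> S \<Longrightarrow> Re (F' z) > 0"
  shows "inj_on F S"
proof (rule inj_onI, rule ccontr)
  fix a b assume ab: "a \<in> S" "b \<in> S" "F a = F b" "a \<noteq> b"
  define \<gamma> where "\<gamma> = (\<lambda>t. a + of_real t * (b - a))"
  have \<gamma>: "\<gamma> t \<in> S" if "0 \<le> t" "t \<le> 1" for t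
    using convexD_alt[OF S ab(1,2) that] by (simp add: \<gamma>_def scaleR_conv_of_real algebra_simps)
  have "((\<lambda>t. Re (F (\<gamma> t) / (b - a))) has_real_derivative Re (F' (\<gamma> t))) (at t)"
    if "0 \<le> t" "t \<le> 1" for t
  proof -
    have "(\<gamma> has_vector_derivative (b - a)) (at t)"
      unfolding \<gamma>_def by (auto intro!: derivative_eq_intros)
    moreover have "((\<lambda>z. F z / (b - a)) has_field_derivative F' (\<gamma> t) / (b - a)) (at (\<gamma> t))"
      by (intro DERIV_cdivide F \<gamma> that)
    ultimately have "((\<lambda>t. F (\<gamma> t) / (b - a)) has_vector_derivative F' (\<gamma> t)) (at t)"
      using field_vector_diff_chain_at[of \<gamma> "b - a" t "\<lambda>z. F z / (b - a)"] ab(4)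
      by (fastforce simp: o_def)
    thus ?thesis
      by (rule has_field_derivative_Re)
  qed
  from MVT2[OF zero_less_one this] obtain t where t: "0 < t" "t < 1"
    "Re (F (\<gamma> 1) / (b - a)) - Re (F (\<gamma> 0) / (b - a)) = (1 - 0) * Re (F' (\<gamma> t))"
    by blast
  hence "Re (F' (\<gamma> t)) = 0"
    using ab(3) by (simp add: \<gamma>_def)
  with pos[OF \<gamma>[of t]] t show False by simp
qed

text \<open>For \<open>f z = z * exp (H z)\<close> one has \<open>z * f' z / f z = 1 + z * H' z\<close>, so this is the statement
  that a starlike function is univalent.\<close>

lemma starlike_imp_inj_on:
  assumes H: "\<And>z. z \<in> ball 0 1 \<Longrightarrow> (H has_field_derivative H' z) (at z)"
    and pos: "\<And>z. z \<in> ball 0 1 \<Longrightarrow> Re (1 + z * H' z) > 0"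
  shows "inj_on (\<lambda>z. z * exp (H z)) (ball 0 1)"
proof -
  define S where "S = {\<zeta>. Re \<zeta> < 0}"
  \<comment> \<open>\<open>F\<close> is a logarithm of \<open>f\<close> in the coordinate \<open>\<zeta> = log z\<close>.\<close>
  define F where "F = (\<lambda>\<zeta>. \<zeta> + H (exp \<zeta>))"
  have exp_ball: "exp \<zeta> \<in> ball 0 1" if "\<zeta> \<in> S" for \<zeta>
    using that by (simp add: S_def)
  have "convex S"
    unfolding S_def by (rule convex_halfspace_Re_lt)
  moreover have "(F has_field_derivative 1 + exp \<zeta> * H' (exp \<zeta>)) (at \<zeta>)" if "\<zeta> \<in> S" for \<zeta>
    unfolding F_def using DERIV_chain2[OF H[OF exp_ball[OF that]] DERIV_exp]
    by (auto intro!: derivative_eq_intros)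
  ultimately have inj: "inj_on F S"
    by (rule inj_on_if_Re_deriv_pos) (use pos exp_ball in auto)
  show ?thesis
  proof (rule inj_onI)
    fix x y :: complex
    assume xy: "x \<in> ball 0 1" "y \<in> ball 0 1" "x * exp (H x) = y * exp (H y)"
    show "x = y"
    proof (cases "x = 0 \<or> y = 0")
      case True
      thus ?thesis using xy(3) by auto
    next
      case False
      have S: "Ln x \<in> S" "Ln y \<in> S"
        using False xy(1,2) by (auto simp: S_def)
      have "exp (F (Ln x)) = exp (F (Ln y))"
        using False xy(3) by (simp add: F_def exp_add)
      then obtain n :: int where n: "F (Ln x) = F (Ln y) + of_int (2 * n) * pi * \<i>"
        by (auto simp: exp_eq)
      \<comment> \<open>Shifting \<open>Ln y\<close> by a period of \<open>exp\<close> shifts \<open>F\<close> by the same amount.\<close>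
      define \<zeta> where "\<zeta> = Ln y + of_int (2 * n) * pi * \<i>"
      have "exp \<zeta> = exp (Ln y)"
        unfolding exp_eq \<zeta>_def by blast
      hence e: "exp \<zeta> = y"
        using False by simp
      hence "F \<zeta> = F (Ln x)"
        using False n by (simp add: F_def \<zeta>_def)
      moreover have "\<zeta> \<in> S"
        using S(2) by (simp add: \<zeta>_def S_def)
      ultimately have "\<zeta> = Ln x"
        using inj S(1) by (auto dest: inj_onD)
      thus ?thesis using e False by auto
    qed
  qed
qed

text \<open>Every Schwarz function \<open>\<omega>\<close> occurs in the subordination of a member of the class:
  the equation \<open>z * f' z / f z = lune (\<omega> z)\<close> is solved by \<open>f z = z * exp (H z)\<close> where
  \<open>z * H' z = lune (\<omega> z) - 1\<close>.\<close>

lemma class_S_lune_of_Schwarz_function: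
  assumes \<omega>: "\<omega> holomorphic_on ball 0 1" "\<omega> 0 = 0" "\<And>z. z \<in> ball 0 1 \<Longrightarrow> cmod (\<omega> z) < 1"
  obtains f where "f \<in> class_S_lune"
    "\<And>z. z \<in> ball 0 1 \<Longrightarrow> z \<noteq> 0 \<Longrightarrow> z * deriv f z / f z = lune (\<omega> z)"
proof -
  define p where "p = (\<lambda>z. lune (\<omega> z))"
  have p: "p holomorphic_on ball 0 1"
    unfolding p_def
    by (rule holomorphic_on_compose_gen[OF \<omega>(1) lune_holomorphic, unfolded o_def])
       (auto simp: \<omega>(3))
  have p0: "p 0 = 1"
    by (simp add: p_def \<omega>(2) lune_def)
  obtain h where h: "h holomorphic_on ball 0 1" "\<And>z. norm z < 1 \<Longrightarrow> p z - 1 = z * h z"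
  proof (rule Schwarz3[of "\<lambda>z. p z - 1" 1])
    show "(\<lambda>z. p z - 1) holomorphic_on ball 0 1"
      by (intro holomorphic_intros p)
  qed (use p0 in auto)
  obtain H0 where H0: "\<And>z. z \<in> ball 0 1 \<Longrightarrow> (H0 has_field_derivative h z) (at z within ball 0 1)"
    using holomorphic_convex_primitive'[OF convex_ball open_ball h(1)] by blast
  define H where "H = (\<lambda>z. H0 z - H0 0)"
  have H: "(H has_field_derivative h z) (at z)" if "z \<in> ball 0 1" for z
    using H0[OF that] that at_within_open[OF that open_ball]
    unfolding H_def by (auto intro!: derivative_eq_intros)
  define f where "f = (\<lambda>z. z * exp (H z))"
  have df: "(f has_field_derivative p z * exp (H z)) (at z)" if "z \<in> ball 0 1" for z
  proof -
    have "(f has_field_derivative exp (H z) + z * (exp (H z) * h z)) (at z)"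
      unfolding f_def using H[OF that] by (auto intro!: derivative_eq_intros)
    also have "exp (H z) + z * (exp (H z) * h z) = (1 + z * h z) * exp (H z)"
      by (simp add: algebra_simps)
    also have "1 + z * h z = p z"
      using h(2)[of z] that by (simp add: algebra_simps)
    finally show ?thesis .
  qed
  have quot: "z * deriv f z / f z = lune (\<omega> z)" if "z \<in> ball 0 1" "z \<noteq> 0" for z
    using DERIV_imp_deriv[OF df[OF that(1)]] that(2) by (simp add: f_def p_def)
  have "f holomorphic_on ball 0 1"
    using df by (meson holomorphic_on_open open_ball)
  moreover have "deriv f 0 = 1"
    using DERIV_imp_deriv[OF df[of 0]] by (simp add: p0 H_def)
  moreover have "inj_on f (ball 0 1)"
    unfolding f_def
  proof (rule starlike_imp_inj_on[OF H])
    fix z :: complex assume z: "z \<in> ball 0 1"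
    have "1 + z * h z = lune (\<omega> z)"
      using h(2)[of z] z by (simp add: p_def algebra_simps)
    thus "Re (1 + z * h z) > 0"
      using Re_lune_pos \<omega>(3)[OF z] by simp
  qed
  ultimately have S: "f \<in> class_S"
    by (simp add: class_S_def class_A_def f_def)
  have eq: "(if z = 0 then 1 else z * deriv f z / f z) = p z" if "z \<in> ball 0 1" for z
    using quot[OF that] p0 by (auto simp: p_def)
  have "(\<lambda>z. if z = 0 then 1 else z * deriv f z / f z) holomorphic_on ball 0 1"
    by (rule holomorphic_transform[OF p]) (use eq in simp)
  hence "subordinate (\<lambda>z. if z = 0 then 1 else z * deriv f z / f z) lune"
    unfolding subordinate_def using lune_holomorphic \<omega> eq unfolding p_def by blast
  with S have "f \<in> class_S_lune"
    by (simp add: class_S_lune_def)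
  thus ?thesis using that quot by blast
qed

section \<open>The inverse logarithmic coefficients\<close>

text \<open>Write \<open>\<ell> w = log (g w / w)\<close> for the local inverse \<open>g\<close>, and \<open>r w = 1 + w * \<ell>' w\<close>.
  Then \<open>r w = w * g' w / g w = 1 / lune (\<omega> (g w))\<close>, and as the reciprocal of \<open>lune u\<close> is
  \<open>csqrt (1 + u\<^sup>2) - u\<close>, the function \<open>r\<close> satisfies \<open>r\<^sup>2 + 2 * u * r = 1\<close> with \<open>u = \<omega> (g w)\<close>.
  Comparing coefficients in this quadratic equation gives those of \<open>\<ell>\<close>.\<close>

lemma inv_log_coeff_1_2:
  assumes f: "f \<in> class_A" and h: "h holomorphic_on ball 0 1"
    and eq: "\<forall>z\<in>ball 0 1 - {0}. z * deriv f z / f z = lune (z * h z)"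
  shows "inv_log_coeff f 1 = - h 0 / 2"
    and "inv_log_coeff f 2 = 3 / 8 * (h 0)\<^sup>2 - deriv h 0 / 4"
proof -
  define g where "g = local_inverse f"
  define l where "l = log_quotient g"
  define L where "L = fps_expansion l 0"
  have lg: "is_local_inverse f g"
    unfolding g_def by (rule is_local_inverse_local_inverse[OF f])
  have hol: "f holomorphic_on ball 0 1" "f 0 = 0"
    using f by (auto simp: class_A_def)
  obtain s where s: "s > 0" "g holomorphic_on ball 0 s" "g 0 = 0"
      "\<And>w. w \<in> ball 0 s \<Longrightarrow> g w \<in> ball 0 1 \<and> f (g w) = w"
    using lg by (auto simp: is_local_inverse_def)
  have an: "l analytic_on {0}"
    unfolding l_def by (rule log_quotient_analytic[OF f lg])
  have L: "l has_fps_expansion L"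
    unfolding L_def using an analytic_at_imp_has_fps_expansion_0 by blast
  have L0: "fps_nth L 0 = 0"
    using has_fps_expansion_imp_0_eq_fps_nth_0[OF L] by (simp add: l_def log_quotient_def)
  have gl: "g w = w * exp (l w)" if "w \<in> ball 0 s" for w
  proof (cases "w = 0")
    case False
    hence "g w \<noteq> 0" using s(4)[OF that] hol(2) by auto
    thus ?thesis using False by (simp add: l_def log_quotient_def)
  qed (simp add: s)

  define E where "E = fps_exp 1 oo L"
  have E: "(\<lambda>w. exp (l w)) has_fps_expansion E"
    unfolding E_def using has_fps_expansion_compose[OF has_fps_expansion_exp1 L L0]
    by (simp add: o_def)
  define G where "G = fps_X * E"
  have "(\<lambda>w. w * exp (l w)) has_fps_expansion G"
    unfolding G_def by (intro fps_expansion_intros E)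
  have ev_s: "eventually (\<lambda>w. w \<in> ball 0 s) (nhds 0)"
    using s(1) by (intro eventually_nhds_in_open) auto
  hence "eventually (\<lambda>w. w * exp (l w) = g w) (nhds 0)"
    by eventually_elim (use gl in auto)
  from has_fps_expansion_cong[OF this refl[of G]] have G: "g has_fps_expansion G"
    using \<open>(\<lambda>w. w * exp (l w)) has_fps_expansion G\<close> by (rule iffD1)
  have E01: "fps_nth E 0 = 1" "fps_nth E 1 = fps_nth L 1"
    by (simp_all add: E_def fps_compose_nth L0)
  have G012: "fps_nth G 0 = 0" "fps_nth G 1 = 1" "fps_nth G 2 = fps_nth L 1"
    using E01 by (simp_all add: G_def)

  define C where "C = fps_expansion h 0"
  have C: "h has_fps_expansion C"
    unfolding C_def using h by (intro has_fps_expansion_fps_expansion[of "ball 0 1"]) auto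
  have C01: "fps_nth C 0 = h 0" "fps_nth C 1 = deriv h 0"
    using fps_nth_fps_expansion[OF C, of 0] fps_nth_fps_expansion[OF C, of 1] by simp_all

  define u where "u = (\<lambda>w. g w * h (g w))"
  define U where "U = G * (C oo G)"
  have U: "u has_fps_expansion U"
    unfolding u_def U_def
    using has_fps_expansion_compose[OF C G G012(1)]
    by (intro fps_expansion_intros G) (simp_all add: o_def)
  have CG: "fps_nth (C oo G) 0 = h 0" "fps_nth (C oo G) 1 = deriv h 0"
    using C01 G012 by (simp_all add: fps_compose_nth)
  have U012: "fps_nth U 0 = 0" "fps_nth U 1 = h 0"
      "fps_nth U 2 = fps_nth L 1 * h 0 + deriv h 0"
    using CG G012 by (simp_all add: U_def fps_mult_nth numeral_2_eq_2)

  define r where "r = (\<lambda>w. 1 + w * deriv l w)"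
  define R where "R = 1 + fps_X * fps_deriv L"
  have R: "r has_fps_expansion R"
    unfolding r_def R_def by (intro fps_expansion_intros L)
  have R012: "fps_nth R 0 = 1" "fps_nth R 1 = fps_nth L 1" "fps_nth R 2 = 2 * fps_nth L 2"
    by (simp_all add: R_def numeral_2_eq_2)

  obtain A where A: "open A" "0 \<in> A" "l holomorphic_on A"
    using an by (auto simp: analytic_at)
  have "eventually (\<lambda>w. w \<in> A) (nhds 0)"
    using A by (intro eventually_nhds_in_open)
  hence quad: "eventually (\<lambda>w. r w * r w + 2 * (u w * r w) = 1) (nhds 0)"
    using ev_s
  proof eventually_elim
    case (elim w)
    show ?case
    proof (cases "w = 0")
      case True
      thus ?thesis by (simp add: r_def u_def s)
    next
      case False
      have gw: "g w \<in> ball 0 1" "f (g w) = w" "g w \<noteq> 0"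
        using s(4)[OF elim(2)] hol(2) False by auto
      have "(l has_field_derivative deriv l w) (at w)"
        using holomorphic_derivI[OF A(3,1) elim(1)] .
      hence "((\<lambda>w. w * exp (l w)) has_field_derivative exp (l w) * r w) (at w)"
        by (auto intro!: derivative_eq_intros simp: r_def algebra_simps)
      hence dg: "(g has_field_derivative exp (l w) * r w) (at w)"
        by (rule has_field_derivative_transform_within_open[OF _ open_ball elim(2)])
           (simp add: gl)
      have "(f has_field_derivative deriv f (g w)) (at (g w))"
        using holomorphic_derivI[OF hol(1) open_ball gw(1)] .
      hence "((\<lambda>w. f (g w)) has_field_derivative deriv f (g w) * (exp (l w) * r w)) (at w)"
        using dg by (rule DERIV_chain2)
      moreover have "((\<lambda>w. f (g w)) has_field_derivative 1) (at w)"
        by (rule has_field_derivative_transform_within_open[OF DERIV_ident open_ball elim(2)])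
           (use s(4) in auto)
      ultimately have "deriv f (g w) * (exp (l w) * r w) = 1"
        by (rule DERIV_unique)
      moreover have "g w * deriv f (g w) = w * lune (u w)"
      proof -
        have "g w * deriv f (g w) / f (g w) = lune (u w)"
          using bspec[OF eq, of "g w"] gw unfolding u_def by blast
        thus ?thesis
          using False by (simp add: gw(2) field_simps)
      qed
      ultimately have "lune (u w) * r w = 1"
        using False gl[OF elim(2)] by (simp add: algebra_simps)
      hence "r w = inverse (lune (u w))"
        by (metis inverse_unique)
      also have "\<dots> = csqrt (1 + (u w)\<^sup>2) - u w"
        using lune_mult_reciprocal by (metis inverse_unique)
      finally have "(r w + u w)\<^sup>2 = 1 + (u w)\<^sup>2"
        by simp
      thus ?thesis
        by (simp add: power2_eq_square algebra_simps)
    qed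
  qed
  have "(\<lambda>w. r w * r w + 2 * (u w * r w)) has_fps_expansion R * R + 2 * (U * R)"
    by (intro fps_expansion_intros R U)
  with has_fps_expansion_cong[OF quad refl[of "R * R + 2 * (U * R)"]]
  have "(\<lambda>_. 1) has_fps_expansion R * R + 2 * (U * R)"
    by (rule iffD1)
  \<comment> \<open>The coefficients of this identity at orders 1 and 2 determine those of \<open>L\<close> at the same orders.\<close>
  hence fps: "R * R + 2 * (U * R) = 1"
    using fps_expansion_unique_complex has_fps_expansion_1 by blast
  have L1: "fps_nth L 1 = - h 0"
  proof -
    have "fps_nth (R * R + 2 * (U * R)) 1 = 2 * (fps_nth L 1 + h 0)"
      using R012 U012 by (simp add: fps_mult_nth fps_numeral_nth algebra_simps)
    thus ?thesis
      unfolding fps by (simp add: add_eq_0_iff)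
  qed
  have "fps_nth (R * R + 2 * (U * R)) 2
          = 4 * fps_nth L 2 + (fps_nth L 1)\<^sup>2
            + 2 * (fps_nth L 1 * h 0 + deriv h 0 + h 0 * fps_nth L 1)"
    using R012 U012
    by (simp add: fps_mult_nth numeral_2_eq_2 fps_numeral_nth algebra_simps)
  hence L2: "4 * fps_nth L 2 = 3 * (h 0)\<^sup>2 - 2 * deriv h 0"
    unfolding fps L1 by (simp add: power2_eq_square algebra_simps)
  show "inv_log_coeff f 1 = - h 0 / 2"
    unfolding inv_log_coeff_def using L1 by (simp add: L_def l_def g_def)
  have "fps_nth L 2 = (3 * (h 0)\<^sup>2 - 2 * deriv h 0) / 4"
    using L2 by (simp add: field_simps)
  thus "inv_log_coeff f 2 = 3 / 8 * (h 0)\<^sup>2 - deriv h 0 / 4"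
    unfolding inv_log_coeff_def by (simp add: L_def l_def g_def field_simps)
qed

section \<open>The bounds and their sharpness\<close>

lemma class_S_lune_bounds:
  assumes "f \<in> class_S_lune"
  shows "- 1 / sqrt 10 \<le> cmod (inv_log_coeff f 2) - cmod (inv_log_coeff f 1)"
    and "cmod (inv_log_coeff f 2) - cmod (inv_log_coeff f 1) \<le> 1 / 4"
proof -
  have f: "f \<in> class_A"
    using assms by (simp add: class_S_lune_def class_S_def)
  obtain \<omega> where \<omega>: "\<omega> holomorphic_on ball 0 1" "\<omega> 0 = 0"
      "\<And>z. z \<in> ball 0 1 \<Longrightarrow> cmod (\<omega> z) < 1"
      "\<And>z. z \<in> ball 0 1 \<Longrightarrow> (if z = 0 then 1 else z * deriv f z / f z) = lune (\<omega> z)"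
    using assms unfolding class_S_lune_def subordinate_def by blast
  obtain h where h: "h holomorphic_on ball 0 1" "\<And>z. norm z < 1 \<Longrightarrow> \<omega> z = z * h z"
    using Schwarz3[OF \<omega>(1,2)] by blast
  have "\<forall>z\<in>ball 0 1 - {0}. z * deriv f z / f z = lune (z * h z)"
  proof
    fix z :: complex assume z: "z \<in> ball 0 1 - {0}"
    thus "z * deriv f z / f z = lune (z * h z)"
      using \<omega>(4)[of z] h(2)[of z] by simp
  qed
  note coeff = inv_log_coeff_1_2[OF f h(1) this]
  define c where "c = cmod (h 0)"
  define d where "d = cmod (deriv h 0)"
  have d: "d \<le> 1 - c\<^sup>2"
    unfolding c_def d_def by (rule Schwarz_Pick_quotient[OF h(1)]) (use \<omega>(3) h(2) in auto)
  have c0: "c \<ge> 0" and d0: "d \<ge> 0"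
    by (simp_all add: c_def d_def)
  have "c\<^sup>2 \<le> 1"
    using d d0 by simp
  hence c1: "c \<le> 1"
    using c0 by (simp add: abs_square_le_1)
  have G1: "cmod (inv_log_coeff f 1) = c / 2"
    unfolding coeff by (simp add: c_def norm_divide)
  have n1: "cmod (3 / 8 * (h 0)\<^sup>2) = 3 / 8 * c\<^sup>2" and n2: "cmod (deriv h 0 / 4) = d / 4"
    by (simp_all add: c_def d_def norm_mult norm_divide norm_power)
  have up: "cmod (inv_log_coeff f 2) \<le> 3 / 8 * c\<^sup>2 + d / 4"
    unfolding coeff using norm_triangle_ineq4[of "3 / 8 * (h 0)\<^sup>2" "deriv h 0 / 4"] n1 n2 by simp
  have low: "cmod (inv_log_coeff f 2) \<ge> 3 / 8 * c\<^sup>2 - d / 4"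
    unfolding coeff using norm_triangle_ineq2[of "3 / 8 * (h 0)\<^sup>2" "deriv h 0 / 4"] n1 n2 by simp
  show "cmod (inv_log_coeff f 2) - cmod (inv_log_coeff f 1) \<le> 1 / 4"
  proof -
    have "c\<^sup>2 \<le> c"
      using c0 c1 by (simp add: power2_eq_square mult_left_le)
    thus ?thesis using up d c0 G1 by linarith
  qed
  define a where "a = 1 / sqrt 10"
  have a: "a > 0" "a\<^sup>2 = 1 / 10"
    by (simp_all add: a_def power_divide)
  have "- a \<le> cmod (inv_log_coeff f 2) - cmod (inv_log_coeff f 1)"
  proof (cases "c \<le> 2 * a")
    case True
    \<comment> \<open>Here \<open>\<bar>\<Gamma>\<^sub>1\<bar> = c / 2 \<le> a\<close> already suffices.\<close>
    thus ?thesis using G1 norm_ge_zero[of "inv_log_coeff f 2"] by linarith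
  next
    case False
    \<comment> \<open>At \<open>c = 2 * a\<close> the lower bound \<open>5 / 8 * c\<^sup>2 - 1 / 4\<close> for \<open>\<bar>\<Gamma>\<^sub>2\<bar>\<close> vanishes, and beyond this
        point it grows faster than \<open>c / 2\<close>.\<close>
    have a4: "a > 1 / 4"
    proof (rule ccontr)
      assume "\<not> a > 1 / 4"
      hence "a\<^sup>2 \<le> (1 / 4)\<^sup>2"
        using a(1) by (intro power_mono) auto
      thus False using a(2) by (simp add: power2_eq_square)
    qed
    have "(c - 2 * a) * (5 / 8 * (c + 2 * a) - 1 / 2) \<ge> 0"
      using False a4 by (intro mult_nonneg_nonneg) auto
    also have "(c - 2 * a) * (5 / 8 * (c + 2 * a) - 1 / 2) = 5 / 8 * c\<^sup>2 - 5 / 2 * a\<^sup>2 - c / 2 + a"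
      by (simp add: power2_eq_square field_simps)
    finally show ?thesis
      using low d G1 a(2) by linarith
  qed
  thus "- 1 / sqrt 10 \<le> cmod (inv_log_coeff f 2) - cmod (inv_log_coeff f 1)"
    by (simp add: a_def)
qed

text \<open>The functions with \<open>\<omega> z = z * (z + c) / (1 + c * z)\<close>, for which equality holds in the
  Schwarz--Pick inequality, with both \<open>h 0\<close> and \<open>deriv h 0\<close> nonnegative.\<close>

lemma class_S_lune_extremal:
  fixes c :: real
  assumes c: "0 \<le> c" "c < 1"
  obtains f where "f \<in> class_S_lune" "cmod (inv_log_coeff f 1) = c / 2"
    "cmod (inv_log_coeff f 2) = \<bar>5 / 8 * c\<^sup>2 - 1 / 4\<bar>"
proof -
  define h where "h = Moebius_function 0 (- of_real c)"
  have nc: "cmod (- of_real c) < 1"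
    using c by simp
  have h: "h holomorphic_on ball 0 1"
    unfolding h_def by (rule Moebius_function_holomorphic[OF nc])
  have h1: "cmod (h z) < 1" if "cmod z < 1" for z
    unfolding h_def by (rule Moebius_function_norm_lt_1[OF nc that])
  have h0: "h 0 = of_real c"
    by (simp add: h_def Moebius_function_of_zero)
  have "(h has_field_derivative 1 - (of_real c)\<^sup>2) (at 0)"
    unfolding h_def Moebius_function_simple
    by (auto intro!: derivative_eq_intros simp: power2_eq_square)
  hence dh: "deriv h 0 = of_real (1 - c\<^sup>2)"
    using DERIV_imp_deriv by fastforce
  have "cmod (z * h z) < 1" if "z \<in> ball 0 1" for z
    using h1[of z] that norm_mult_less[of z 1 "h z" 1] by simp
  moreover have "(\<lambda>z. z * h z) holomorphic_on ball 0 1"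
    by (intro holomorphic_intros h)
  ultimately obtain f where f: "f \<in> class_S_lune"
      "\<And>z. z \<in> ball 0 1 \<Longrightarrow> z \<noteq> 0 \<Longrightarrow> z * deriv f z / f z = lune (z * h z)"
    using class_S_lune_of_Schwarz_function[of "\<lambda>z. z * h z"] by auto
  have eq: "\<forall>z\<in>ball 0 1 - {0}. z * deriv f z / f z = lune (z * h z)"
    using f(2) by blast
  have "f \<in> class_A"
    using f(1) by (simp add: class_S_lune_def class_S_def)
  note coeff = inv_log_coeff_1_2[OF this h eq]
  have "cmod (inv_log_coeff f 1) = c / 2"
    using c unfolding coeff by (simp add: h0 norm_divide)
  moreover have "inv_log_coeff f 2 = of_real (5 / 8 * c\<^sup>2 - 1 / 4)"
    unfolding coeff h0 dh by (simp add: field_simps)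
  hence "cmod (inv_log_coeff f 2) = \<bar>5 / 8 * c\<^sup>2 - 1 / 4\<bar>"
    by (simp only: norm_of_real)
  ultimately show ?thesis
    using that f(1) by blast
qed

theorem theorem2p3:
  shows "(\<forall>f\<in>class_S_lune.
            - 1 / sqrt 10 \<le> cmod (inv_log_coeff f 2) - cmod (inv_log_coeff f 1) \<and>
            cmod (inv_log_coeff f 2) - cmod (inv_log_coeff f 1) \<le> 1 / 4) \<and>
         (\<exists>f\<in>class_S_lune.
            cmod (inv_log_coeff f 2) - cmod (inv_log_coeff f 1) = - 1 / sqrt 10) \<and>
         (\<exists>f\<in>class_S_lune.
            cmod (inv_log_coeff f 2) - cmod (inv_log_coeff f 1) = 1 / 4)"
proof (intro conjI ballI)
  \<comment> \<open>For this \<open>c\<close> the extremal function has \<open>\<Gamma>\<^sub>2 = 0\<close>.\<close>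
  define c where "c = 2 / sqrt 10"
  have "c\<^sup>2 = 2 / 5"
    by (simp add: c_def power_divide)
  have "c \<ge> 0" "c < 1"
    by (simp_all add: c_def real_less_rsqrt)
  then obtain f where "f \<in> class_S_lune" "cmod (inv_log_coeff f 1) = c / 2"
      "cmod (inv_log_coeff f 2) = \<bar>5 / 8 * c\<^sup>2 - 1 / 4\<bar>"
    using class_S_lune_extremal[of c] by blast
  thus "\<exists>f\<in>class_S_lune. cmod (inv_log_coeff f 2) - cmod (inv_log_coeff f 1) = - 1 / sqrt 10"
    by (intro bexI[of _ f]) (simp_all only: \<open>c\<^sup>2 = 2 / 5\<close>, simp add: c_def)
next
  obtain f where "f \<in> class_S_lune" "cmod (inv_log_coeff f 1) = 0 / 2"
      "cmod (inv_log_coeff f 2) = \<bar>5 / 8 * 0\<^sup>2 - 1 / 4\<bar>"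
    using class_S_lune_extremal[of 0] zero_less_one by blast
  thus "\<exists>f\<in>class_S_lune. cmod (inv_log_coeff f 2) - cmod (inv_log_coeff f 1) = 1 / 4"
    by (intro bexI[of _ f]) (simp_all only:, simp)
qed (use class_S_lune_bounds in auto)

end
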